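(* Let $\mathbb{N}=\{1,2,3,\dots\}$. (1) For every $k\ge 1$ and every non-self-loop function $S:\mathbb{N}^k\to\mathbb{Z}$, there exists $B\subset\mathbb{N}$ such that $\langle B,S\rangle$ is an $\mathbb{N}$-Induction Model. In particular this holds for every $S$ with additive structure and for every $S$ with multiplicative structure. (2) For every non-empty $B\subset\mathbb{N}$, there exist $k\ge1$ and a function $S:\mathbb{N}^k\to\mathbb{Z}$ such that $\langle B,S\rangle$ is an $\mathbb{N}$-Induction Model; moreover such an $S$ can be chosen with additive structure. If $|B|\ge 2$, such an $S$ can also be chosen with multiplicative structure.
   Context: A function $F:\mathbb{N}^k\to\mathbb{Z}$ is a self-loop function if $F(x_1,\dots,x_k)\in\{x_1,\dots,x_k\}$ for every $(x_1,\dots,x_k)\in\mathbb{N}^k$; otherwise it is a non-self-loop function. $F$ has additive structure if $F(x_1,\dots,x_k)=a_0+a_1x_1+\dots+a_kx_k$ with all $a_i\in\mathbb{Z}$ and $a_i\neq0$ for $1\le i\le k$. $F$ has multiplicative structure if $F(x_1,\dots,x_k)=\sum_{I\subseteq\{1,\dots,k\}} a_I\prod_{j\in I}x_j$ with $a_I\in\mathbb{Z}$ and the coefficient $a_{\{1,\dots,k\}}$ of $x_1x_2\cdots x_k$ nonzero. For a non-empty $B\subseteq\mathbb{N}$ and $S:\mathbb{N}^k\to\mathbb{Z}$, the pair $\langle B,S\rangle$ is an $\mathbb{N}$-Induction Model if the following holds: whenever $G\subseteq\mathbb{N}$ satisfies (i) $B\subseteq G$ and (ii) for all $x_1,\dots,x_k\in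 G$ (not necessarily distinct) with $S(x_1,\dots,x_k)\in\mathbb{N}$ we have $S(x_1,\dots,x_k)\in G$, then $G=\mathbb{N}$.
   Formalization: In (1), B ⊂ ℕ is read as B ⊆ ℕ, since with proper subsets the claim fails, e.g. for S(x) = −x or the additive S(x) = x; a proper subset B is asserted exactly when some value S(x_1,…,x_k) lies in ℕ and is not among x_1,…,x_k. *)

theory Defs
  imports Main "HOL-Library.FuncSet"
begin

text \<open>
  The positive integers are taken as a set of integers, so that their elements and the values
  of a function \<open>F : N^k \<rightarrow> Z\<close> live in the same type. A k-tuple over \<open>A\<close> is an
  extensional function on \<open>{1..k}\<close>; since every such function has a fixed value outside
  \<open>{1..k}\<close>, a function on tuples depends only on the k entries. The values of
  \<open>F :: (nat \<Rightarrow> int) \<Rightarrow> int\<close> outside \<open>tuples k NN\<close> play no role in any definition below.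
\<close>

definition NN :: "int set" where
  "NN = {1..}"

definition tuples :: "nat \<Rightarrow> int set \<Rightarrow> (nat \<Rightarrow> int) set" where
  "tuples k A = {1..k} \<rightarrow>\<^sub>E A"

definition self_loop :: "nat \<Rightarrow> ((nat \<Rightarrow> int) \<Rightarrow> int) \<Rightarrow> bool" where
  "self_loop k F \<longleftrightarrow> (\<forall>x\<in>tuples k NN. F x \<in> x ` {1..k})"

definition additive_structure :: "nat \<Rightarrow> ((nat \<Rightarrow> int) \<Rightarrow> int) \<Rightarrow> bool" where
  "additive_structure k F \<longleftrightarrow>
     (\<exists>a :: nat \<Rightarrow> int. (\<forall>i\<in>{1..k}. a i \<noteq> 0) \<and>
        (\<forall>x\<in>tuples k NN. F x = a 0 + (\<Sum>i\<in>{1..k}. a i * x i)))"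

definition multiplicative_structure :: "nat \<Rightarrow> ((nat \<Rightarrow> int) \<Rightarrow> int) \<Rightarrow> bool" where
  "multiplicative_structure k F \<longleftrightarrow>
     (\<exists>a :: nat set \<Rightarrow> int. a {1..k} \<noteq> 0 \<and>
        (\<forall>x\<in>tuples k NN. F x = (\<Sum>I\<in>Pow {1..k}. a I * (\<Prod>j\<in>I. x j))))"

definition induction_model :: "nat \<Rightarrow> int set \<Rightarrow> ((nat \<Rightarrow> int) \<Rightarrow> int) \<Rightarrow> bool" where
  "induction_model k B S \<longleftrightarrow>
     B \<noteq> {} \<and> B \<subseteq> NN \<and>
     (\<forall>G. G \<subseteq> NN \<longrightarrow> B \<subseteq> G \<longrightarrow>
        (\<forall>x\<in>tuples k G. S x \<in> NN \<longrightarrow> S x \<in> G) \<longrightarrow> G = NN)"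

end

theory Submission
  imports Defs
begin

text \<open>
  In the first part one may take \<open>B\<close> to be all positive integers, or all but one value of \<open>S\<close>
  outside its own arguments. For the second part fix any \<open>b \<in> B\<close> and
  let \<open>S x y z = 1 + x + y - z\<close>. Taking \<open>y = z\<close> yields successors, hence
  everything from \<open>b\<close> upwards, and then \<open>S b b (b + 1 + m) = b - m\<close> reaches
  everything below. The multilinear variant adds a term \<open>(w - b) * x * y * z\<close>,
  which vanishes at \<open>w = b\<close>.
\<close>

lemma induction_model_NN: "induction_model k NN S"
  by (auto simp: induction_model_def NN_def)

text \<open>As \<open>S x\<close> is not an entry of \<open>x\<close>, deleting it leaves
  \<open>x\<close> a tuple over the smaller set, and closure under \<open>S\<close> restores the
  only missing point.\<close>

lemma induction_model_minus_value:
  assumes x: "x \<in> tuples k NN" and "S x \<in> NN" and S: "S x \<notin> x ` {1..k}"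
    and k: "k \<ge> 1"
  shows "induction_model k (NN - {S x}) S"
proof -
  have x': "x \<in> tuples k (NN - {S x})"
    using x S unfolding tuples_def PiE_iff by force
  \<comment> \<open>An induction model needs a nonempty base; \<open>k \<ge> 1\<close> provides an
    entry to serve as witness.\<close>
  have "x 1 \<in> NN - {S x}"
    using x' k by (auto simp: tuples_def PiE_iff)
  moreover have "G = NN"
    if "G \<subseteq> NN" "NN - {S x} \<subseteq> G" "\<forall>y\<in>tuples k G. S y \<in> NN \<longrightarrow> S y \<in> G" for G
  proof -
    have "x \<in> tuples k G"
      using x' that(2) by (auto simp: tuples_def PiE_iff)
    then show ?thesis
      using that \<open>S x \<in> NN\<close> by blast
  qed
  ultimately show ?thesis
    unfolding induction_model_def by blast
qed

text \<open>Common core of the additive and multiplicative cases, phrased with plain integers so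
  that tuples enter only where it is applied.\<close>

lemma closed_eq_NN:
  assumes G: "G \<subseteq> NN" and b: "b \<in> G"
    and closed: "\<And>x y z. \<lbrakk>x \<in> G; y \<in> G; z \<in> G; 1 + x + y - z \<in> NN\<rbrakk> \<Longrightarrow> 1 + x + y - z \<in> G"
  shows "G = NN"
proof
  have up: "n \<in> G" if "b \<le> n" for n
    using that
  proof (induction n rule: int_ge_induct)
    case base
    show ?case by (rule b)
  next
    case (step n)
    then show ?case
      using closed[of n b b] G b by (auto simp: NN_def algebra_simps)
  qed
  show "NN \<subseteq> G"
  proof
    fix n assume n: "n \<in> NN"
    show "n \<in> G"
    proof (cases "b \<le> n")
      case True
      then show ?thesis by (rule up)
    next
      case False
      \<comment> \<open>The third argument comes from solving \<open>1 + b + b - z = n\<close> for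
        \<open>z\<close>; it exceeds \<open>b\<close> because \<open>n < b\<close>.\<close>
      then have "2 * b + 1 - n \<in> G"
        by (intro up) auto
      then show ?thesis
        using closed[of b b "2 * b + 1 - n"] b n by simp
    qed
  qed
qed (rule G)

definition add_step :: "(nat \<Rightarrow> int) \<Rightarrow> int" where
  "add_step x = 1 + x 1 + x 2 - x 3"

text \<open>Multiplying \<open>x 4 - b\<close> by all the other variables gives the full monomial
  coefficient 1, as a multiplicative structure demands.\<close>

definition mult_step :: "int \<Rightarrow> (nat \<Rightarrow> int) \<Rightarrow> int" where
  "mult_step b x = 1 + x 1 + x 2 - x 3 + (x 4 - b) * (x 1 * x 2 * x 3)"

lemma additive_structure_add_step: "additive_structure 3 add_step"
  unfolding additive_structure_def
proof (intro exI[of _ "\<lambda>i. if i = 3 then - 1 else 1"] conjI ballI)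
  fix x :: "nat \<Rightarrow> int"
  have "{1..3} = {1, 2, 3 :: nat}" by auto
  then show "add_step x = (if 0 = (3::nat) then - 1 else 1) + (\<Sum>i\<in>{1..3}. (if i = 3 then - 1 else 1) * x i)"
    by (simp add: add_step_def)
qed auto

lemma multiplicative_structure_mult_step: "multiplicative_structure 4 (mult_step b)"
proof -
  \<comment> \<open>Coefficients of the expanded polynomial; \<open>T\<close> below contains their
    support, cutting the sum over 16 subsets to six terms.\<close>
  define a :: "nat set \<Rightarrow> int" where "a = (\<lambda>_. 0)({} := 1, {1} := 1, {2} := 1, {3} := - 1,
    {1, 2, 3} := - b, {1..4} := 1)"
  define T :: "nat set set" where "T = {{}, {1}, {2}, {3}, {1, 2, 3}, {1..4}}"
  have I4: "{1..4} = {1, 2, 3, 4 :: nat}" by auto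
  \<comment> \<open>Distinctness of the index sets lets the simplifier evaluate the function updates
    and split the sum over \<open>T\<close>.\<close>
  have ne: "{1, 2, 3 :: nat} \<noteq> {1, 2, 3, 4}" "{1, 2, 3 :: nat} \<noteq> {n}" "{1, 2, 3, 4 :: nat} \<noteq> {n}" for n
    by auto
  have "mult_step b x = (\<Sum>I\<in>Pow {1..4}. a I * (\<Prod>j\<in>I. x j))" for x
  proof -
    have "(\<Sum>I\<in>Pow {1..4}. a I * (\<Prod>j\<in>I. x j)) = (\<Sum>I\<in>T. a I * (\<Prod>j\<in>I. x j))"
      by (rule sum.mono_neutral_right) (auto simp: T_def a_def)
    also have "\<dots> = mult_step b x"
      unfolding T_def a_def I4 using ne ne[symmetric]
      by (simp add: mult_step_def algebra_simps)
    finally show ?thesis ..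
  qed
  moreover have "a {1..4} \<noteq> 0" by (simp add: a_def)
  ultimately show ?thesis
    unfolding multiplicative_structure_def by blast
qed

lemma induction_model_add_step:
  assumes "B \<subseteq> NN" "b \<in> B"
  shows "induction_model 3 B add_step"
  unfolding induction_model_def
proof (intro conjI allI impI)
  fix G assume G: "G \<subseteq> NN" "B \<subseteq> G" "\<forall>x\<in>tuples 3 G. add_step x \<in> NN \<longrightarrow> add_step x \<in> G"
  show "G = NN"
  proof (rule closed_eq_NN)
    fix x y z assume xyz: "x \<in> G" "y \<in> G" "z \<in> G" "1 + x + y - z \<in> NN"
    \<comment> \<open>The restricted lambda makes \<open>t\<close> extensional; the shift reconciles
      indices from 1 with list positions from 0.\<close>
    define t where "t = (\<lambda>i\<in>{1..3::nat}. [x, y, z] ! (i - 1))"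
    have "t \<in> tuples 3 G"
      using xyz by (auto simp: t_def tuples_def nth_Cons split: nat.split)
    moreover have "add_step t = 1 + x + y - z"
      by (simp add: add_step_def t_def)
    ultimately show "1 + x + y - z \<in> G"
      using G(3) xyz(4) by fastforce
  qed (use G assms in auto)
qed (use assms in auto)

lemma induction_model_mult_step:
  assumes "B \<subseteq> NN" "b \<in> B"
  shows "induction_model 4 B (mult_step b)"
  unfolding induction_model_def
proof (intro conjI allI impI)
  fix G assume G: "G \<subseteq> NN" "B \<subseteq> G" "\<forall>x\<in>tuples 4 G. mult_step b x \<in> NN \<longrightarrow> mult_step b x \<in> G"
  show "G = NN"
  proof (rule closed_eq_NN)
    fix x y z assume xyz: "x \<in> G" "y \<in> G" "z \<in> G" "1 + x + y - z \<in> NN"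
    \<comment> \<open>The fourth entry \<open>b\<close> lies in \<open>B\<close>, hence in
      \<open>G\<close>, and annihilates the product term.\<close>
    define t where "t = (\<lambda>i\<in>{1..4::nat}. [x, y, z, b] ! (i - 1))"
    have "t \<in> tuples 4 G"
      using xyz G(2) assms(2) by (auto simp: t_def tuples_def nth_Cons split: nat.split)
    moreover have "mult_step b t = 1 + x + y - z"
      by (simp add: mult_step_def t_def)
    ultimately show "1 + x + y - z \<in> G"
      using G(3) xyz(4) by fastforce
  qed (use G assms in auto)
qed (use assms in auto)

theorem theorem1:
  shows
   "((\<forall>k\<ge>1. \<forall>S. \<not> self_loop k S \<longrightarrow> (\<exists>B\<subseteq>NN. induction_model k B S)) \<and>
     (\<forall>k\<ge>1. \<forall>S. additive_structure k S \<longrightarrow> (\<exists>B\<subseteq>NN. induction_model k B S)) \<and>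
     (\<forall>k\<ge>1. \<forall>S. multiplicative_structure k S \<longrightarrow> (\<exists>B\<subseteq>NN. induction_model k B S)) \<and>
     (\<forall>k\<ge>1. \<forall>S. (\<exists>x\<in>tuples k NN. S x \<in> NN \<and> S x \<notin> x ` {1..k}) \<longrightarrow>
        (\<exists>B\<subset>NN. induction_model k B S))) \<and>
    (\<forall>B. B \<noteq> {} \<and> B \<subseteq> NN \<longrightarrow>
       (\<exists>k\<ge>1. \<exists>S. induction_model k B S) \<and>
       (\<exists>k\<ge>1. \<exists>S. additive_structure k S \<and> induction_model k B S) \<and>
       (infinite B \<or> card B \<ge> 2 \<longrightarrow>
          (\<exists>k\<ge>1. \<exists>S. multiplicative_structure k S \<and> induction_model k B S)))"
proof (intro conjI allI impI)
  fix k :: nat and S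
  assume "k \<ge> 1" and "\<exists>x\<in>tuples k NN. S x \<in> NN \<and> S x \<notin> x ` {1..k}"
  then obtain x where "S x \<in> NN" "induction_model k (NN - {S x}) S"
    using induction_model_minus_value by blast
  then show "\<exists>B\<subset>NN. induction_model k B S"
    by (intro exI[of _ "NN - {S x}"]) auto
next
  fix B assume "B \<noteq> {} \<and> B \<subseteq> NN"
  then obtain b where b: "B \<subseteq> NN" "b \<in> B" by blast
  have "(1::nat) \<le> 3" by simp
  then show "\<exists>k\<ge>1. \<exists>S. additive_structure k S \<and> induction_model k B S"
    using additive_structure_add_step induction_model_add_step[OF b] by blast
  then show "\<exists>k\<ge>1. \<exists>S. induction_model k B S" by blast
  have "(1::nat) \<le> 4" by simp
  then show "\<exists>k\<ge>1. \<exists>S. multiplicative_structure k S \<and> induction_model k B S"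
    using multiplicative_structure_mult_step induction_model_mult_step[OF b] by blast
\<comment> \<open>The remaining goals are the first three existence claims; they allow
  \<open>B = NN\<close>.\<close>
qed (use induction_model_NN in blast)+

end
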